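(* Let $m\ge n\ge 1$, let $A\in\mathbb{C}^{m\times n}$ have rank $n$ and rows of Euclidean norm $1$, let $b\in\mathbb{C}^m$ be such that $Ax=b$ is solvable, and let $x\in\mathbb{C}^n$ denote its solution. Let $p$ be an integer, let $x_k\in\mathbb{C}^n$ be a given iterate at which the selection probabilities of Algorithm 1 (Randomized Weighted Kaczmarz with parameter $p$) are well defined, and let $x_{k+1}$ be the next iterate computed from $x_k$. Let $\mathbb{E}_{\mathrm{Alg1}}$ and $\mathbb{E}_{\mathrm{Alg2}}$ be the conditional expectations given $x_k$ corresponding to the probability distribution on the row index $i\in\{1,\dots,m\}$ implied by the row selection step of Algorithm 1 and of Algorithm 2 (Non-Randomized Greedy Kaczmarz), respectively. Then $$\mathbb{E}_{\mathrm{Alg2}}\|x_{k+1}-x\|_2^2\;\le\;\mathbb{E}_{\mathrm{Alg1}}\|x_{k+1}-x\|_2^2 .$$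
   Context: Notation: $\langle u,v\rangle=u^*v$ is the standard inner product on $\mathbb{C}^n$ and $\|\cdot\|_2$ is the Euclidean norm. The vector $a_i\in\mathbb{C}^n$ is the $i$-th row of $A$ regarded as a column vector so that $(Ay)_i=\langle a_i,y\rangle$ for all $y\in\mathbb{C}^n$ (that is, the $i$-th row of $A$ is $a_i^*$); thus $\|a_i\|_2=1$ for all $i$. For a given $x_k\in\mathbb{C}^n$, the residuals are $r_k(i)=b_i-\langle a_i,x_k\rangle$, $i=1,\dots,m$. In both algorithms, one step selects a row index $i\in\{1,\dots,m\}$ and sets $$x_{k+1}=x_k+r_k(i)\,a_i .$$ Algorithm 1 (Randomized Weighted Kaczmarz, with a given integer $p$) selects row $i$ at random with probability $$p_k(i)=\frac{|r_k(i)|^p}{\sum_{j=1}^m|r_k(j)|^p}.$$ These probabilities are well defined when all the powers $|r_k(j)|^p$ are defined and the denominator is nonzero (for $p>0$ this means that the residuals are not all zero). Algorithm 2 (Non-Randomized Greedy Kaczmarz) selects a row $i_\ast$ with $|r_k(i_\ast)|=\max_{j}|r_k(j)|$ (any such maximizer), i.e. its selection distribution assigns probability $1$ to $i_\ast$. Given $x_k$, and for a selection distribution $\mathrm{prob}(i)$, $i=1,\dots,m$, the corresponding conditional expectation is $$\mathbb{E}\|x_{k+1}-x\|_2^2=\sum_{i=1}^m \mathrm{prob}(i)\,\|x_k+r_k(i)a_i-x\|_2^2 .$$ Both expectations in the claim are conditional on the same given $x_k$. *)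

theory Defs
  imports "HOL-Analysis.Analysis"
begin

definition cinner :: "complex ^ 'n \<Rightarrow> complex ^ 'n \<Rightarrow> complex" where
  "cinner u v = (\<Sum>j\<in>UNIV. cnj (u $ j) * v $ j)"

(* The i-th row of A is the conjugate transpose of the column vector rowvec A i. *)
definition rowvec :: "complex ^ 'n ^ 'm \<Rightarrow> 'm \<Rightarrow> complex ^ 'n" where
  "rowvec A i = (\<chi> j. cnj (row i A $ j))"

lemma matrix_vector_mult_rowvec: "(A *v y) $ i = cinner (rowvec A i) y"
  by (simp add: matrix_vector_mult_def cinner_def rowvec_def row_def)

definition residual :: "complex ^ 'n ^ 'm \<Rightarrow> complex ^ 'm \<Rightarrow> complex ^ 'n \<Rightarrow> 'm \<Rightarrow> complex" where
  "residual A b y i = b $ i - cinner (rowvec A i) y"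

definition kaczmarz_step ::
  "complex ^ 'n ^ 'm \<Rightarrow> complex ^ 'm \<Rightarrow> complex ^ 'n \<Rightarrow> 'm \<Rightarrow> complex ^ 'n" where
  "kaczmarz_step A b y i = y + residual A b y i *s rowvec A i"

definition rwk_denom ::
  "complex ^ 'n ^ 'm \<Rightarrow> complex ^ 'm \<Rightarrow> int \<Rightarrow> complex ^ 'n \<Rightarrow> real" where
  "rwk_denom A b p y = (\<Sum>j\<in>UNIV. cmod (residual A b y j) powi p)"

(* Negative powers of 0 count as undefined (in HOL they equal 0), and 0 to the power 0 is 1. *)
definition rwk_well_defined ::
  "complex ^ 'n ^ 'm \<Rightarrow> complex ^ 'm \<Rightarrow> int \<Rightarrow> complex ^ 'n \<Rightarrow> bool" where
  "rwk_well_defined A b p y \<longleftrightarrow>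
     (p < 0 \<longrightarrow> (\<forall>j. residual A b y j \<noteq> 0)) \<and> rwk_denom A b p y \<noteq> 0"

definition rwk_prob ::
  "complex ^ 'n ^ 'm \<Rightarrow> complex ^ 'm \<Rightarrow> int \<Rightarrow> complex ^ 'n \<Rightarrow> 'm \<Rightarrow> real" where
  "rwk_prob A b p y i = cmod (residual A b y i) powi p / rwk_denom A b p y"

(* Ties are possible, so the greedy choice is a predicate rather than a function. *)
definition greedy_row ::
  "complex ^ 'n ^ 'm \<Rightarrow> complex ^ 'm \<Rightarrow> complex ^ 'n \<Rightarrow> 'm \<Rightarrow> bool" where
  "greedy_row A b y i \<longleftrightarrow>
     cmod (residual A b y i) = Max (range (\<lambda>j. cmod (residual A b y j)))"

definition greedy_prob :: "'m \<Rightarrow> 'm \<Rightarrow> real" where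
  "greedy_prob i\<^sub>0 i = (if i = i\<^sub>0 then 1 else 0)"

(* Expectation, given the current iterate y, of the squared error of the next iterate
   when the row index is distributed according to prob. *)
definition expected_sq_error ::
  "('m \<Rightarrow> real) \<Rightarrow> complex ^ 'n ^ 'm \<Rightarrow> complex ^ 'm \<Rightarrow> complex ^ 'n \<Rightarrow> complex ^ 'n \<Rightarrow> real" where
  "expected_sq_error prob A b x y =
     (\<Sum>i\<in>UNIV. prob i * (norm (kaczmarz_step A b y i - x))\<^sup>2)"

end

theory Submission
  imports Defs
begin

text \<open>By Pythagoras, a step with row i lowers the squared error by exactly the squared modulus
  of the i-th residual (\<open>kaczmarz_step_sq_error\<close>). A row of largest residual therefore
  gives the smallest squared error that one step can reach. The expectation for Algorithm 1 averages
  the errors of all rows, with weights that are nonnegative (\<open>rwk_prob_nonneg\<close>) and sum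
  to 1 (\<open>sum_rwk_prob\<close>), so it cannot fall below this minimum.\<close>

lemma norm_vec_power2: "(norm (v :: 'a::real_normed_vector ^ 'n))\<^sup>2 = (\<Sum>j\<in>UNIV. (norm (v $ j))\<^sup>2)"
  by (simp add: norm_vec_def L2_set_def sum_nonneg)

lemma norm_rowvec: "norm (rowvec A i) = norm (row i A)"
  by (simp add: norm_vec_def rowvec_def)

text \<open>Law of cosines: \<open>cinner\<close> is conjugate linear in its first argument, so the
  cross term is twice the real part of \<open>cinner (r *s a) e\<close>. The scalar identity is
  summed over the coordinates.\<close>

lemma norm_add_scaled_power2:
  fixes e a :: "complex ^ 'n"
  shows "(norm (e + r *s a))\<^sup>2
    = (norm e)\<^sup>2 + 2 * Re (cnj r * cinner a e) + (cmod r)\<^sup>2 * (norm a)\<^sup>2"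
proof -
  have "(cmod (u + r * w))\<^sup>2 = (cmod u)\<^sup>2 + 2 * Re (cnj r * (cnj w * u)) + (cmod r)\<^sup>2 * (cmod w)\<^sup>2"
    for u w :: complex
    unfolding cmod_power2 by (simp add: power2_eq_square algebra_simps)
  then show ?thesis
    by (simp add: norm_vec_power2 cinner_def sum.distrib sum_distrib_left)
qed

text \<open>The step projects orthogonally onto the hyperplane of the selected equation, which contains
  the solution; this is Pythagoras' theorem.\<close>

lemma kaczmarz_step_sq_error:
  assumes "norm (row i A) = 1" and "A *v x = b"
  shows "(norm (kaczmarz_step A b y i - x))\<^sup>2 = (norm (y - x))\<^sup>2 - (cmod (residual A b y i))\<^sup>2"
proof -
  \<comment> \<open>Consistency of the system enters here: \<open>b = A *v x\<close> turns the
    residual into an inner product with the error \<open>y - x\<close>.\<close>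
  have r: "cinner (rowvec A i) (y - x) = - residual A b y i"
    by (simp add: residual_def matrix_vector_mult_rowvec [symmetric] matrix_vector_mult_diff_distrib
        flip: assms(2))
  have "kaczmarz_step A b y i - x = (y - x) + residual A b y i *s rowvec A i"
    by (simp add: kaczmarz_step_def)
  \<comment> \<open>As the row has norm 1, the cross term is -2 times the squared modulus of the
    residual and the last term is +1 times it.\<close>
  then show ?thesis
    using assms(1)
    by (simp only: norm_add_scaled_power2 r norm_rowvec) (simp add: cmod_power2 flip: power2_eq_square)
qed

lemma greedy_row_max: "greedy_row A b y i\<^sub>0 \<Longrightarrow> cmod (residual A b y i) \<le> cmod (residual A b y i\<^sub>0)"
  by (simp add: greedy_row_def)

lemma rwk_prob_nonneg: "0 \<le> rwk_prob A b p y i"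
  by (simp add: rwk_prob_def rwk_denom_def sum_nonneg)

text \<open>Well-definedness makes the normalising denominator nonzero; with denominator 0, division
  in HOL would make the total 0.\<close>

lemma sum_rwk_prob:
  assumes "rwk_well_defined A b p y"
  shows "(\<Sum>i\<in>UNIV. rwk_prob A b p y i) = 1"
  using assms
  by (simp add: rwk_prob_def rwk_well_defined_def flip: sum_divide_distrib rwk_denom_def)

lemma sum_greedy_prob: "(\<Sum>i\<in>UNIV. greedy_prob i\<^sub>0 i * f i) = f (i\<^sub>0 :: 'm::finite)"
  by (simp add: greedy_prob_def if_distrib [of "\<lambda>c. c * _"] cong: if_cong)

theorem mainTheorem1:
  fixes A :: "complex ^ 'n ^ 'm" and b :: "complex ^ 'm"
    and x x\<^sub>k :: "complex ^ 'n" and p :: int and i\<^sub>0 :: 'm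
  assumes "CARD('n) \<le> CARD('m)"
    and "rank A = CARD('n)"
    and "\<And>i. norm (row i A) = 1"
    and "A *v x = b"
    and "rwk_well_defined A b p x\<^sub>k"
    and "greedy_row A b x\<^sub>k i\<^sub>0"
  shows "expected_sq_error (greedy_prob i\<^sub>0) A b x x\<^sub>k
       \<le> expected_sq_error (rwk_prob A b p x\<^sub>k) A b x x\<^sub>k"
proof -
  let ?err = "\<lambda>i. (norm (kaczmarz_step A b x\<^sub>k i - x))\<^sup>2"
  have le: "?err i\<^sub>0 \<le> ?err i" for i
    by (simp add: kaczmarz_step_sq_error [OF assms(3,4)] greedy_row_max [OF assms(6)] power_mono)
  have "expected_sq_error (greedy_prob i\<^sub>0) A b x x\<^sub>k = ?err i\<^sub>0"
    by (simp add: expected_sq_error_def sum_greedy_prob)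
  \<comment> \<open>The constant greedy error is written as its own average under the weights of
    Algorithm 1, so that the two sums can be compared term by term.\<close>
  also have "\<dots> = (\<Sum>i\<in>UNIV. rwk_prob A b p x\<^sub>k i * ?err i\<^sub>0)"
    by (simp add: sum_rwk_prob [OF assms(5)] flip: sum_distrib_right)
  also have "\<dots> \<le> expected_sq_error (rwk_prob A b p x\<^sub>k) A b x x\<^sub>k"
    unfolding expected_sq_error_def by (intro sum_mono mult_left_mono le rwk_prob_nonneg)
  finally show ?thesis .
qed

end
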